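(* A spectral measure over $\mathbb{T}^2$ of the graph $\mathcal{E}_1^{(12)}$ (with its distinguished vertex $\ast$) is $$\mathrm{d}\varepsilon=\frac{2-\sqrt3}{12}\,\mathrm{d}^{((12))}+\frac{2+\sqrt3}{12}\,\mathrm{d}^{((12/5))}+\frac{1}{36\pi^4}J^2\,\mathrm{d}^{(4)}.$$ That is, $\int_{\mathbb{T}^2}R_{m,n}\,\mathrm{d}\varepsilon=\langle \Delta^m(\Delta^{\ast})^{n}e_{\ast},e_{\ast}\rangle$ for all integers $m,n\ge 0$, where $\Delta$ is the adjacency matrix of $\mathcal{E}_1^{(12)}$.
   Context: $\mathbb{T}$ is the unit circle in $\mathbb{C}$. For integers $m,n\ge0$ put $R_{m,n}(\omega_1,\omega_2)=(\omega_1+\omega_2^{-1}+\omega_1^{-1}\omega_2)^m(\omega_1^{-1}+\omega_2+\omega_1\omega_2^{-1})^{n}$. For a finite directed graph with normal adjacency matrix $\Delta$ (entry $\Delta_{v,w}$ = number of edges from $v$ to $w$) and a vertex $v$, a measure $\varepsilon$ on $\mathbb{T}^2$ is called a spectral measure over $\mathbb{T}^2$ at $v$ if $\int_{\mathbb{T}^2} R_{m,n}\,\mathrm{d}\varepsilon=\langle\Delta^m(\Delta^{\ast})^{n}e_v,e_v\rangle$ for all $m,n\ge0$, with $e_v$ the basis vector of $v$. The group $S_3$ acts on $\mathbb{T}^2$, generated by $(\omega_1,\omega_2)\mapsto(\omega_2^{-1},\omega_1^{-1})$ and $(\omega_1,\omega_2)\mapsto(\omega_2^{-1},\omega_1\omega_2^{-1})$.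 With $\omega=e^{2\pi i/3}$ and, for rational $s\ge2$, $\tau=e^{2\pi i/s}$, $\mathrm{d}^{((s))}$ is the uniform probability measure on the union of the $S_3$-orbits of $(\tau,\tau)$, $(\overline{\omega}\,\overline{\tau},\omega)$, $(\omega,\overline{\omega}\,\overline{\tau})$. For $N\in\mathbb{N}$, $\mathrm{d}^{(N)}$ is the uniform probability measure on $D_N=\{(e^{2\pi iq_1/3N},e^{2\pi iq_2/3N}) : q_1,q_2\in\{0,\dots,3N-1\},\ q_1+q_2\equiv0 \bmod 3\}$. $J$ is the function on $\mathbb{T}^2$ given at $(e^{2\pi i\theta_1},e^{2\pi i\theta_2})$ by $J=4\pi^2\big(\sin(2\pi(\theta_1+\theta_2))-\sin(2\pi(2\theta_1-\theta_2))-\sin(2\pi(2\theta_2-\theta_1))\big)$, and $J^2\mathrm{d}^{(N)}$ is the measure with density $J^2$ with respect to $\mathrm{d}^{(N)}$. The graph $\mathcal{E}_1^{(12)}$ (the nimrep graph of the conformal inclusion $SU(3)_9\subset(\mathrm{E}_6)_1$) has 12 vertices $a,b,c$ and $a_i,b_i,c_i$ ($i=1,2,3$), and the following edges (single unless stated), for $i=1,2,3$: $a_i\to b_i$; $a\to b_i$; $a\to b$ (double edge); $b_i\to c_i$; $b_i\to c$; $b\to c_i$; $b\to c$; $c_i\to a_i$; $c_i\to a$; $c\to a$ (double edge). The distinguished vertex is $\ast=a_1$ (a vertex of lowest Perron-Frobenius weight). *)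

theory Defs
  imports "HOL-Analysis.Analysis" "Graph_Theory.Digraph"
begin

section \<open>Spectral measures of a graph over the torus\<close>

definition torus :: "(complex \<times> complex) set" where
  "torus = sphere 0 1 \<times> sphere 0 1"

definition torus_borel :: "(complex \<times> complex) measure" where
  "torus_borel = restrict_space borel torus"

definition R :: "nat \<Rightarrow> nat \<Rightarrow> complex \<times> complex \<Rightarrow> complex" where
  "R m n = (\<lambda>(w1, w2). (w1 + inverse w2 + inverse w1 * w2) ^ m *
                       (inverse w1 + w2 + w1 * inverse w2) ^ n)"

text \<open>A \<open>pre_digraph\<close> may have parallel arcs, which the adjacency matrix counts.\<close>

definition adjacency :: "('v::finite, 'e) pre_digraph \<Rightarrow> complex ^ 'v ^ 'v" where
  "adjacency G = (\<chi> v w. of_nat (card {e \<in> arcs G. tail G e = v \<and> head G e = w}))"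

definition adjoint_mat :: "complex ^ 'v ^ 'v \<Rightarrow> complex ^ 'v ^ 'v" where
  "adjoint_mat A = (\<chi> i j. cnj (A $ j $ i))"

definition normal_mat :: "complex ^ 'v::finite ^ 'v \<Rightarrow> bool" where
  "normal_mat A \<longleftrightarrow> A ** adjoint_mat A = adjoint_mat A ** A"

text \<open>The library's \<open>*\<close> and \<open>^\<close> on type \<open>vec\<close> are componentwise,
  so powers with respect to \<open>**\<close> need a definition.\<close>

primrec mat_power :: "complex ^ 'v::finite ^ 'v \<Rightarrow> nat \<Rightarrow> complex ^ 'v ^ 'v" where
  "mat_power A 0 = mat 1"
| "mat_power A (Suc n) = A ** mat_power A n"

definition hermitian_inner :: "complex ^ 'v::finite \<Rightarrow> complex ^ 'v \<Rightarrow> complex" where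
  "hermitian_inner x y = (\<Sum>v\<in>UNIV. x $ v * cnj (y $ v))"

text \<open>The vertex set is a whole finite type, so that it can index the adjacency matrix.
  \<open>has_bochner_integral\<close> says that the integral exists and has the given value; the case
  \<open>m = n = 0\<close> forces \<open>\<epsilon>\<close> to have total mass one.\<close>

definition spectral_measure_at ::
    "('v::finite, 'e) pre_digraph \<Rightarrow> 'v \<Rightarrow> (complex \<times> complex) measure \<Rightarrow> bool" where
  "spectral_measure_at G v \<epsilon> \<longleftrightarrow>
     fin_digraph G \<and> verts G = UNIV \<and> normal_mat (adjacency G) \<and>
     space \<epsilon> = torus \<and> sets \<epsilon> = sets torus_borel \<and>
     (\<forall>m n. has_bochner_integral \<epsilon> (R m n)
        (hermitian_inner
          ((mat_power (adjacency G) m ** mat_power (adjoint_mat (adjacency G)) n) *v axis v 1)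
          (axis v 1)))"


section \<open>Measures on the torus\<close>

definition uniform_on :: "(complex \<times> complex) set \<Rightarrow> (complex \<times> complex) measure" where
  "uniform_on S = distr (uniform_count_measure S) torus_borel (\<lambda>p. p)"

text \<open>Intended for measures on a common \<open>\<sigma>\<close>-algebra only.\<close>

definition add_measure :: "'a measure \<Rightarrow> 'a measure \<Rightarrow> 'a measure" where
  "add_measure M N = measure_of (space M) (sets M) (\<lambda>A. emeasure M A + emeasure N A)"

lemma space_add_measure [simp]: "space (add_measure M N) = space M"
  and sets_add_measure [simp]: "sets (add_measure M N) = sets M"
  by (simp_all add: add_measure_def)

lemma emeasure_add_measure:
  assumes "sets N = sets M" "A \<in> sets M"
  shows "emeasure (add_measure M N) A = emeasure M A + emeasure N A"
  unfolding add_measure_def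
proof (rule emeasure_measure_of_sigma)
  show "sigma_algebra (space M) (sets M)" ..
  show "positive (sets M) (\<lambda>A. emeasure M A + emeasure N A)"
    by (simp add: positive_def)
  show "countably_additive (sets M) (\<lambda>A. emeasure M A + emeasure N A)"
  proof (rule countably_additiveI)
    fix F :: "nat \<Rightarrow> _" assume "range F \<subseteq> sets M" "disjoint_family F"
    then show "(\<Sum>i. emeasure M (F i) + emeasure N (F i)) =
        emeasure M (\<Union>i. F i) + emeasure N (\<Union>i. F i)"
      using assms(1) by (simp add: suminf_add [symmetric] suminf_emeasure)
  qed
qed fact

text \<open>The two generators have orders 2 and 3, so closing under them alone, without
  inverses, already yields the orbit of the group they generate.\<close>

inductive_set S3_orbit :: "complex \<times> complex \<Rightarrow> (complex \<times> complex) set"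
  for p :: "complex \<times> complex" where
  base: "p \<in> S3_orbit p"
| order2: "(w1, w2) \<in> S3_orbit p \<Longrightarrow> (inverse w2, inverse w1) \<in> S3_orbit p"
| order3: "(w1, w2) \<in> S3_orbit p \<Longrightarrow> (inverse w2, w1 * inverse w2) \<in> S3_orbit p"

text \<open>The measure \<open>d\<^sup>(\<^sup>(\<^sup>s\<^sup>)\<^sup>)\<close>, meant for \<open>s \<ge> 2\<close>.\<close>

definition d_orbits :: "rat \<Rightarrow> (complex \<times> complex) measure" where
  "d_orbits s =
    (let \<omega> = cis (2 * pi / 3); \<tau> = cis (2 * pi / of_rat s)
     in uniform_on (S3_orbit (\<tau>, \<tau>) \<union>
          S3_orbit (cnj \<omega> * cnj \<tau>, \<omega>) \<union> S3_orbit (\<omega>, cnj \<omega> * cnj \<tau>)))"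

definition D :: "nat \<Rightarrow> (complex \<times> complex) set" where
  "D N = {(cis (2 * pi * real q1 / (3 * real N)), cis (2 * pi * real q2 / (3 * real N))) | q1 q2.
            q1 < 3 * N \<and> q2 < 3 * N \<and> (q1 + q2) mod 3 = 0}"

definition d_grid :: "nat \<Rightarrow> (complex \<times> complex) measure" where
  "d_grid N = uniform_on (D N)"

definition J_angle :: "real \<Rightarrow> real \<Rightarrow> real" where
  "J_angle \<theta>1 \<theta>2 = 4 * pi\<^sup>2 * (sin (2 * pi * (\<theta>1 + \<theta>2))
     - sin (2 * pi * (2 * \<theta>1 - \<theta>2)) - sin (2 * pi * (2 * \<theta>2 - \<theta>1)))"

definition J :: "complex \<times> complex \<Rightarrow> real" where
  "J = (\<lambda>(w1, w2). J_angle (Arg w1 / (2 * pi)) (Arg w2 / (2 * pi)))"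

text \<open>\<open>J\<close> does not depend on the choice of the angles.\<close>

lemma J_cis: "J (cis (2 * pi * \<theta>1), cis (2 * pi * \<theta>2)) = J_angle \<theta>1 \<theta>2"
proof -
  have Im: "J_angle a b = 4 * pi\<^sup>2 *
      (Im (cis (2 * pi * a) * cis (2 * pi * b))
       - Im (cis (2 * pi * a) ^ 2 * inverse (cis (2 * pi * b)))
       - Im (cis (2 * pi * b) ^ 2 * inverse (cis (2 * pi * a))))" for a b
  proof -
    have "sin (2 * pi * (a + b)) = Im (cis (2 * pi * a) * cis (2 * pi * b))"
      by (simp only: cis_mult cis.sel distrib_left)
    moreover have "sin (2 * pi * (2 * x - y)) = Im (cis (2 * pi * x) ^ 2 * inverse (cis (2 * pi * y)))" for x y
    proof -
      have "cis (2 * pi * x) ^ 2 * inverse (cis (2 * pi * y)) = cis (2 * pi * (2 * x - y))"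
        by (simp add: power2_eq_square cis_mult algebra_simps)
      then show ?thesis by simp
    qed
    ultimately show ?thesis unfolding J_angle_def by presburger
  qed
  have "cis (2 * pi * (Arg (cis t) / (2 * pi))) = cis t" for t
    by (simp add: cis_Arg sgn_div_norm)
  then show ?thesis
    by (simp only: J_def Im prod.case)
qed


section \<open>The graph $\mathcal{E}_1^{(12)}$\<close>

text \<open>\<open>A\<close>, \<open>B\<close>, \<open>C\<close> stand for $a$, $b$, $c$ and \<open>Ai i\<close>, \<open>Bi i\<close>, \<open>Ci i\<close>
  for $a_i$, $b_i$, $c_i$, where the type \<open>3\<close> has the elements \<open>1, 2, 3\<close> (with \<open>3 = 0\<close>).\<close>

datatype vertex = A | B | C | Ai 3 | Bi 3 | Ci 3

instance vertex :: finite
proof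
  have "UNIV = {A, B, C} \<union> range Ai \<union> range Bi \<union> range Ci"
    by (auto intro: vertex.exhaust)
  then show "finite (UNIV :: vertex set)"
    by (metis finite.emptyI finite_UnI finite_imageI finite_insert finite)
qed

text \<open>An arc \<open>(v, w, k)\<close> goes from \<open>v\<close> to \<open>w\<close>; the label \<open>k\<close> tells parallel arcs apart.\<close>

definition E1_12 :: "(vertex, vertex \<times> vertex \<times> nat) pre_digraph" where
  "E1_12 = \<lparr> verts = UNIV,
     arcs = (\<Union>i. {(Ai i, Bi i, 0), (A, Bi i, 0), (Bi i, Ci i, 0), (Bi i, C, 0),
                   (B, Ci i, 0), (Ci i, Ai i, 0), (Ci i, A, 0)}) \<union>
            {(A, B, 0), (A, B, 1), (B, C, 0), (C, A, 0), (C, A, 1)},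
     tail = (\<lambda>(v, w, k). v), head = (\<lambda>(v, w, k). w) \<rparr>"

lemma fin_digraph_E1_12: "fin_digraph E1_12"
  by unfold_locales (auto simp: E1_12_def)

end

theory Submission
  imports Defs
begin

text \<open>
  All three measures live on finitely many points whose coordinates are twelfth roots of unity.
  On \<open>D 4\<close> the density \<open>J\<^sup>2\<close> takes only the values \<open>0\<close> and \<open>64 \<pi>\<^sup>4\<close>, and its support is exactly that of
  \<open>d\<^sup>(\<^sup>(\<^sup>4\<^sup>)\<^sup>)\<close>; so the third summand is \<open>2 / 3\<close> times \<open>d\<^sup>(\<^sup>(\<^sup>4\<^sup>)\<^sup>)\<close>, and only the measures \<open>d\<^sup>(\<^sup>(\<^sup>s\<^sup>)\<^sup>)\<close>
  with \<open>s = 12, 12 / 5, 4\<close> matter. Since \<open>R m n\<close> is invariant under \<open>S\<^sub>3\<close>, it takes three values on the support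
  of \<open>d\<^sup>(\<^sup>(\<^sup>s\<^sup>)\<^sup>)\<close>, namely \<open>\<lambda>\<^sup>m\<close> times the \<open>n\<close>-th power of the conjugate of \<open>\<lambda>\<close>,
  where \<open>\<lambda> = (1 + 2 cos (2 \<pi> / s)) \<zeta>\<close> and \<open>\<zeta>\<^sup>3 = 1\<close>. These nine \<open>\<lambda>\<close> are the eigenvalues \<open>(1 \<plusminus> \<surd>3) \<zeta>\<close>, \<open>\<zeta>\<close> of
  the graph, and writing the basis vector of the distinguished vertex as a sum of joint eigenvectors
  of the adjacency matrix and its adjoint gives the moments on the other side.
\<close>

section \<open>Finitely supported measures\<close>

text \<open>Pushing the point measure forward along the identity places it on the sigma-algebra of
  \<open>M\<close>. Once all summands share one \<open>S\<close>, scaling, adding and taking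
  densities act on the weights alone.\<close>

definition atomic_measure :: "'a measure \<Rightarrow> 'a set \<Rightarrow> ('a \<Rightarrow> real) \<Rightarrow> 'a measure" where
  "atomic_measure M S w = distr (point_measure S (\<lambda>p. ennreal (w p))) M (\<lambda>p. p)"

lemma space_atomic_measure [simp]: "space (atomic_measure M S w) = space M"
  and sets_atomic_measure [simp, measurable_cong]: "sets (atomic_measure M S w) = sets M"
  by (simp_all add: atomic_measure_def)

lemma nn_integral_atomic_measure:
  assumes "finite S" "S \<subseteq> space M" "f \<in> borel_measurable M"
  shows "(\<integral>\<^sup>+p. f p \<partial>atomic_measure M S w) = (\<Sum>p\<in>S. ennreal (w p) * f p)"
  using assms unfolding atomic_measure_def
  by (subst nn_integral_distr) (auto simp: nn_integral_point_measure_finite)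

lemma emeasure_atomic_measure:
  assumes "finite S" "S \<subseteq> space M" "X \<in> sets M"
  shows "emeasure (atomic_measure M S w) X = (\<Sum>p\<in>S \<inter> X. ennreal (w p))"
  using assms by (simp add: nn_integral_atomic_measure Int_def flip: nn_integral_indicator)

text \<open>The measure only sees \<open>ennreal (w p)\<close>, which cuts negative weights off at
  0; nonnegativity is what lets \<open>w p\<close> itself appear in the value.\<close>

lemma has_bochner_integral_atomic_measure:
  fixes f :: "'a \<Rightarrow> 'b::{banach, second_countable_topology}"
  assumes "finite S" "S \<subseteq> space M" "f \<in> borel_measurable M" "\<And>p. p \<in> S \<Longrightarrow> 0 \<le> w p"
  shows "has_bochner_integral (atomic_measure M S w) f (\<Sum>p\<in>S. w p *\<^sub>R f p)"
proof -
  have "integrable (point_measure S (\<lambda>p. ennreal (w p))) f"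
    using assms(1)
    by (auto simp: integrable_iff_bounded nn_integral_point_measure_finite
        ennreal_mult_less_top)
  then show ?thesis
    unfolding atomic_measure_def using assms
    by (intro has_bochner_integral_distr)
      (auto simp: has_bochner_integral_iff lebesgue_integral_point_measure_finite)
qed

lemma scale_atomic_measure:
  assumes "finite S" "S \<subseteq> space M" "0 \<le> c"
  shows "scale_measure (ennreal c) (atomic_measure M S w) = atomic_measure M S (\<lambda>p. c * w p)"
  by (rule measure_eqI)
    (use assms in \<open>simp_all add: emeasure_atomic_measure sum_distrib_left ennreal_mult'\<close>)

lemma density_atomic_measure:
  assumes "finite S" "S \<subseteq> space M" "h \<in> borel_measurable M" "\<And>p. 0 \<le> h p"
  shows "density (atomic_measure M S w) (\<lambda>p. ennreal (h p)) = atomic_measure M S (\<lambda>p. h p * w p)"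
proof (rule measure_eqI)
  fix X assume "X \<in> sets (density (atomic_measure M S w) (\<lambda>p. ennreal (h p)))"
  with assms have "emeasure (density (atomic_measure M S w) (\<lambda>p. ennreal (h p))) X =
      (\<Sum>p\<in>S. ennreal (h p) * ennreal (w p) * indicator X p)"
    by (simp add: emeasure_density nn_integral_atomic_measure mult_ac)
  with assms \<open>X \<in> _\<close> show "emeasure (density (atomic_measure M S w) (\<lambda>p. ennreal (h p))) X =
      emeasure (atomic_measure M S (\<lambda>p. h p * w p)) X"
    by (simp add: emeasure_atomic_measure ennreal_mult' Int_def)
qed simp

lemma add_atomic_measure:
  assumes "finite S" "S \<subseteq> space M" "\<And>p. p \<in> S \<Longrightarrow> 0 \<le> v p" "\<And>p. p \<in> S \<Longrightarrow> 0 \<le> w p"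
  shows "add_measure (atomic_measure M S v) (atomic_measure M S w) =
    atomic_measure M S (\<lambda>p. v p + w p)"
  by (rule measure_eqI)
    (use assms in \<open>simp_all add: emeasure_add_measure emeasure_atomic_measure
      sum.distrib\<close>)

section \<open>Measures and functions on the torus\<close>

lemma space_torus_borel: "space torus_borel = torus"
  by (simp add: torus_borel_def space_restrict_space)

text \<open>Points of \<open>S\<close> outside \<open>T\<close> get weight 0, so uniform measures on
  different sets can be written over one common support.\<close>

lemma uniform_on_eq_atomic_measure:
  assumes "finite S" "S \<subseteq> torus" "T \<subseteq> S"
  shows "uniform_on T = atomic_measure torus_borel S (\<lambda>p. indicator T p / card T)"
proof (rule measure_eqI)
  fix X assume "X \<in> sets (uniform_on T)"
  then have X: "X \<in> sets torus_borel" by (simp add: uniform_on_def)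
  have T: "finite T" "T \<subseteq> space torus_borel"
    using assms finite_subset by (auto simp: space_torus_borel)
  have "uniform_on T = atomic_measure torus_borel T (\<lambda>p. 1 / card T)"
    by (cases "card T = 0") (use T in \<open>simp_all add: uniform_on_def uniform_count_measure_def atomic_measure_def\<close>)
  then have "emeasure (uniform_on T) X = (\<Sum>p\<in>T \<inter> X. ennreal (1 / card T))"
    using T X by (simp add: emeasure_atomic_measure)
  also have "\<dots> = (\<Sum>p\<in>S \<inter> X. ennreal (indicator T p / card T))"
    using assms by (intro sum.mono_neutral_cong_left) (auto simp: indicator_def)
  finally show "emeasure (uniform_on T) X = emeasure (atomic_measure torus_borel S (\<lambda>p. indicator T p / card T)) X"
    using assms X by (simp add: emeasure_atomic_measure space_torus_borel)
qed (simp add: uniform_on_def)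

lemma borel_measurable_torus:
  assumes "continuous_on torus f"
  shows "f \<in> borel_measurable torus_borel"
  unfolding torus_borel_def using assms by (rule borel_measurable_continuous_on_restrict)

lemma continuous_on_R: "continuous_on torus (R m n)"
  unfolding R_def case_prod_beta by (intro continuous_intros) (auto simp: torus_def)

text \<open>\<open>J\<close> is defined through \<open>Arg\<close>, which is not continuous; since
  \<open>cis (Arg z) = z\<close> on the circle, \<open>J\<close> is there a continuous expression in
  the coordinates. This yields its measurability.\<close>

lemma J_torus:
  assumes "(x, y) \<in> torus"
  shows "J (x, y) = 4 * pi\<^sup>2 * (Im (x * y) - Im (x\<^sup>2 * inverse y) - Im (y\<^sup>2 * inverse x))"
proof -
  have *: "cis (Arg z) = z" if "cmod z = 1" for z
    using that by (metis cis_Arg norm_zero sgn_eq div_by_1 of_real_1 zero_neq_one)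
  define a b where "a = Arg x / (2 * pi)" and "b = Arg y / (2 * pi)"
  have xy: "x = cis (2 * pi * a)" "y = cis (2 * pi * b)"
    using assms by (simp_all add: a_def b_def * torus_def)
  show ?thesis
    unfolding xy J_cis J_angle_def
    by (simp del: cis.simps inverse_complex.simps add: cis_mult power2_eq_square cis_inverse algebra_simps)
      simp
qed

lemma borel_measurable_J: "J \<in> borel_measurable torus_borel"
proof -
  have "continuous_on torus (\<lambda>p. 4 * pi\<^sup>2 * (Im (fst p * snd p)
      - Im ((fst p)\<^sup>2 * inverse (snd p)) - Im ((snd p)\<^sup>2 * inverse (fst p))))"
    by (intro continuous_intros) (auto simp: torus_def)
  moreover have "continuous_on torus J \<longleftrightarrow> continuous_on torus (\<lambda>p. 4 * pi\<^sup>2 * (Im (fst p * snd p)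
      - Im ((fst p)\<^sup>2 * inverse (snd p)) - Im ((snd p)\<^sup>2 * inverse (fst p))))"
    by (rule continuous_on_cong) (auto simp: J_torus)
  ultimately show ?thesis
    by (intro borel_measurable_torus) simp
qed

lemma sum_indicator_scaleR_subset:
  fixes f :: "'a \<Rightarrow> complex"
  assumes "finite S" "T \<subseteq> S"
  shows "(\<Sum>p\<in>S. (c * (indicator T p / d)) *\<^sub>R f p) = of_real (c / d) * (\<Sum>p\<in>T. f p)"
proof -
  have "(\<Sum>p\<in>S. (c * (indicator T p / d)) *\<^sub>R f p) = (\<Sum>p\<in>T. of_real (c / d) * f p)"
    using assms by (intro sum.mono_neutral_cong_right) (auto simp: indicator_def scaleR_conv_of_real)
  then show ?thesis by (simp add: sum_distrib_left)
qed

section \<open>Supports of the measures\<close>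

text \<open>The six-point list is closed under both generators. Conversely, the order 3 generator
  gives three of the points, and the order 2 generator applied to these gives the others.\<close>

lemma S3_orbit_eq:
  assumes "x \<noteq> 0" "y \<noteq> 0"
  shows "S3_orbit (x, y) = {(x, y), (inverse y, inverse x), (inverse y, x * inverse y),
    (y * inverse x, inverse x), (y * inverse x, y), (x, x * inverse y)}" (is "_ = ?O")
proof (rule equalityI; rule subsetI)
  have cancel: "x * (inverse x * z) = z" "y * (inverse y * z) = z" for z
    using assms by (simp_all flip: mult.assoc)
  have cancel': "inverse x * (x * z) = z" "inverse y * (y * z) = z" for z
    using assms by (simp_all flip: mult.assoc)
  fix p assume "p \<in> S3_orbit (x, y)"
  then show "p \<in> ?O"
    by induction (auto simp: cancel cancel' assms ac_simps)
next
  have 1: "(x, y) \<in> S3_orbit (x, y)" by (rule S3_orbit.base)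
  have 2: "(inverse y, x * inverse y) \<in> S3_orbit (x, y)" using S3_orbit.order3[OF 1] .
  have 3: "(y * inverse x, inverse x) \<in> S3_orbit (x, y)"
    using S3_orbit.order3[OF 2] assms by (simp add: field_simps)
  have 4: "(inverse y, inverse x) \<in> S3_orbit (x, y)" using S3_orbit.order2[OF 1] .
  have 5: "(y * inverse x, y) \<in> S3_orbit (x, y)"
    using S3_orbit.order2[OF 2] by (simp add: mult.commute)
  have 6: "(x, x * inverse y) \<in> S3_orbit (x, y)"
    using S3_orbit.order2[OF 3] by (simp add: mult.commute)
  fix p assume "p \<in> ?O"
  then show "p \<in> S3_orbit (x, y)"
    using 1 2 3 4 5 6 by auto
qed

text \<open>The action permutes the three terms \<open>x\<close>, \<open>inverse y\<close>,
  \<open>y * inverse x\<close> of the first factor, and hence their inverses, the terms of the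
  second.\<close>

lemma R_S3_orbit:
  assumes "x \<noteq> 0" "y \<noteq> 0" "p \<in> S3_orbit (x, y)"
  shows "R m n p = R m n (x, y)"
proof -
  have cancel: "x * (inverse x * z) = z" "y * (inverse y * z) = z"
    "x * (y * (inverse x * z)) = y * z" "x * (y * inverse x) = y"
    "x * (y * inverse y) = x" "y * (x * inverse x) = y"
    "y * (inverse x * inverse y) = inverse x" "x * (inverse x * inverse y) = inverse y"
    "y * (x * (inverse y * z)) = x * z" "y * (x * inverse y) = x" for z
    using assms by (simp_all add: field_simps)
  show ?thesis
    using assms(3) unfolding S3_orbit_eq[OF assms(1,2)]
    by (elim insertE emptyE) (simp_all add: R_def cancel ac_simps)
qed

text \<open>All points in play have twelfth roots of unity as coordinates, and are indexed by their
  exponents, which matter modulo 12.\<close>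

definition grid12 :: "int \<times> int \<Rightarrow> complex \<times> complex" where
  "grid12 = (\<lambda>(a, b). (cis (pi * real_of_int a / 6), cis (pi * real_of_int b / 6)))"

definition mod12 :: "int \<times> int \<Rightarrow> int \<times> int" where
  "mod12 = (\<lambda>(a, b). (a mod 12, b mod 12))"

lemma cis_eq_iff_mod12: "cis (pi * a / 6) = cis (pi * b / 6) \<longleftrightarrow> a mod 12 = b mod 12" for a b :: int
proof -
  have "cis (pi * a / 6) = cis (pi * b / 6) \<longleftrightarrow> (\<exists>n::int. pi * a / 6 = pi * b / 6 + 2 * pi * n)"
    unfolding sin_cos_eq_iff[symmetric] complex_eq_iff by auto
  moreover have "pi * a / 6 = pi * b / 6 + 2 * pi * n \<longleftrightarrow> a = b + 12 * n" for n :: int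
  proof -
    have "pi * b / 6 + 2 * pi * n = pi * real_of_int (b + 12 * n) / 6"
      by (simp add: field_simps)
    then show ?thesis by (simp del: of_int_add of_int_mult)
  qed
  moreover have "(\<exists>n. a = b + 12 * n) \<longleftrightarrow> a mod 12 = b mod 12"
    by (metis mod_eqE mod_mult_self2)
  ultimately show ?thesis by simp
qed

lemma grid12_eq_iff: "grid12 p = grid12 q \<longleftrightarrow> mod12 p = mod12 q"
  by (simp add: grid12_def mod12_def cis_eq_iff_mod12 split: prod.split)

lemma grid12_mod12: "grid12 (mod12 p) = grid12 p"
  by (simp add: grid12_eq_iff) (simp add: mod12_def split: prod.split)

text \<open>The orbit written additively on exponents. They stay unreduced integers, so that
  \<open>k\<close> may remain symbolic while concrete cases can be evaluated.\<close>

definition orbit12 :: "int \<times> int \<Rightarrow> (int \<times> int) set" where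
  "orbit12 = (\<lambda>(a, b). {(a, b), (- b, - a), (- b, a - b), (b - a, - a), (b - a, b), (a, a - b)})"

lemma S3_orbit_grid12: "S3_orbit (grid12 q) = grid12 ` orbit12 q"
proof -
  have inv: "inverse (cis (pi * c / 6)) = cis (pi * (- c) / 6)" for c
    by simp
  have mult: "cis (pi * c / 6) * cis (pi * d / 6) = cis (pi * (c + d) / 6)" for c d
    by (simp add: cis_mult field_simps)
  show ?thesis
    by (cases q) (simp only: grid12_def orbit12_def prod.case S3_orbit_eq cis_neq_zero not_False_eq_True
        inv mult image_insert image_empty minus_minus add_uminus_conv_diff of_int_minus of_int_diff)
qed

text \<open>The support of \<open>d\<^sup>(\<^sup>(\<^sup>s\<^sup>)\<^sup>)\<close> for \<open>s = 12 / k\<close>.\<close>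

definition support12 :: "int \<Rightarrow> (int \<times> int) set" where
  "support12 k = orbit12 (k, k) \<union> orbit12 (- 4 - k, 4) \<union> orbit12 (4, - 4 - k)"

text \<open>Here \<open>cis (2 * pi / 3)\<close> has exponent 4 and
  \<open>cis (2 * pi / of_rat s)\<close> has exponent \<open>k\<close>, so the product of their
  conjugates has exponent \<open>- 4 - k\<close>.\<close>

lemma d_orbits_eq:
  assumes "12 / of_rat s = real_of_int k"
  shows "d_orbits s = uniform_on (grid12 ` support12 k)"
proof -
  have s: "2 * pi / of_rat s = pi * k / 6"
    by (simp flip: assms)
  have "cnj (cis (2 * pi / 3)) * cnj (cis (pi * k / 6)) = cis (pi * real_of_int (- 4 - k) / 6)"
    by (simp add: cis_cnj cis_mult diff_divide_distrib right_diff_distrib)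
  moreover have "cis (2 * pi / 3) = cis (pi * real_of_int 4 / 6)"
    by simp
  ultimately show ?thesis
    unfolding d_orbits_def support12_def image_Un S3_orbit_grid12[symmetric] s Let_def
    by (simp only: grid12_def prod.case)
qed

lemma support12_card:
  assumes "k \<in> {1, 3, 5}"
  shows "card (mod12 ` support12 k) = 18" "card (support12 k) = 18"
    and "card (orbit12 (k, k)) = 6" "card (orbit12 (- 4 - k, 4)) = 6" "card (orbit12 (4, - 4 - k)) = 6"
proof -
  have "\<forall>k\<in>set [1, 3, 5]. card (mod12 ` support12 k) = 18 \<and> card (support12 k) = 18 \<and>
      card (orbit12 (k, k)) = 6 \<and> card (orbit12 (- 4 - k, 4)) = 6 \<and> card (orbit12 (4, - 4 - k)) = 6"
    by code_simp
  with assms show "card (mod12 ` support12 k) = 18" "card (support12 k) = 18"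
    "card (orbit12 (k, k)) = 6" "card (orbit12 (- 4 - k, 4)) = 6" "card (orbit12 (4, - 4 - k)) = 6"
    by auto
qed

lemma support12_disjoint:
  assumes "k \<in> {1, 3, 5}"
  shows "orbit12 (k, k) \<inter> orbit12 (- 4 - k, 4) = {}"
    and "(orbit12 (k, k) \<union> orbit12 (- 4 - k, 4)) \<inter> orbit12 (4, - 4 - k) = {}"
proof -
  have "\<forall>k\<in>set [1, 3, 5]. orbit12 (k, k) \<inter> orbit12 (- 4 - k, 4) = {} \<and>
      (orbit12 (k, k) \<union> orbit12 (- 4 - k, 4)) \<inter> orbit12 (4, - 4 - k) = {}"
    by code_simp
  with assms show "orbit12 (k, k) \<inter> orbit12 (- 4 - k, 4) = {}"
    "(orbit12 (k, k) \<union> orbit12 (- 4 - k, 4)) \<inter> orbit12 (4, - 4 - k) = {}"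
    by auto
qed

text \<open>Reduction modulo 12 keeps the cardinality 18, so it is injective on this finite set, and
  \<open>grid12\<close> identifies only exponents that agree modulo 12.\<close>

lemma inj_on_support12:
  assumes "k \<in> {1, 3, 5}"
  shows "inj_on grid12 (support12 k)"
proof -
  have "inj_on mod12 (support12 k)"
    using support12_card[OF assms] by (intro eq_card_imp_inj_on) (auto simp: support12_def orbit12_def)
  then show ?thesis
    by (simp add: inj_on_def grid12_eq_iff)
qed

section \<open>Moments of the orbit measures\<close>

abbreviation (input) omega :: complex where "omega \<equiv> cis (2 * pi / 3)"

lemma omega_sq: "omega\<^sup>2 = cnj omega" and omega_sum: "1 + omega + omega\<^sup>2 = 0"
proof -
  have c: "cos (2 * pi / 3) = - 1 / 2" "sin (2 * pi / 3) = sqrt 3 / 2"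
    using cos_120 sin_120 by (simp_all add: field_simps)
  show "omega\<^sup>2 = cnj omega" "1 + omega + omega\<^sup>2 = 0"
    by (simp_all add: complex_eq_iff c power2_eq_square)
qed

lemma R_torus:
  assumes "cmod x = 1" "cmod y = 1"
  shows "R m n (x, y) = (x + cnj y + cnj x * y) ^ m * cnj (x + cnj y + cnj x * y) ^ n"
proof -
  have "inverse x = cnj x" "inverse y = cnj y"
    using assms by (auto intro!: inverse_unique simp flip: complex_norm_square)
  then show ?thesis by (simp add: R_def ac_simps)
qed

text \<open>\<open>R m n\<close> is constant on each of the three disjoint six-point orbits, which
  gives the factor 6. At the three representatives its base is \<alpha> times 1,
  \<open>omega\<^sup>2\<close> and \<open>omega\<close>, in this order.\<close>

lemma sum_R_support12:
  fixes m n k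
  assumes "k \<in> {1, 3, 5}"
  defines "\<alpha> \<equiv> complex_of_real (1 + 2 * cos (pi * k / 6))"
  shows "(\<Sum>p\<in>grid12 ` support12 k. R m n p) =
    6 * (\<Sum>\<zeta>\<leftarrow>[1, omega, omega\<^sup>2]. (\<alpha> * \<zeta>) ^ m * (\<alpha> * \<zeta>\<^sup>2) ^ n)"
proof -
  have orb: "(\<Sum>p\<in>orbit12 q. R m n (grid12 p)) = of_nat (card (orbit12 q)) * R m n (grid12 q)" for q
  proof -
    have "R m n (grid12 p) = R m n (grid12 q)" if "p \<in> orbit12 q" for p
    proof -
      have "grid12 p \<in> S3_orbit (grid12 q)" using that by (simp add: S3_orbit_grid12)
      then show ?thesis
        using R_S3_orbit[of "fst (grid12 q)" "snd (grid12 q)"] by (simp add: grid12_def split: prod.splits)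
    qed
    then show ?thesis by simp
  qed
  note card = support12_card[OF assms(1)]
  note disj = support12_disjoint[OF assms(1)]
  have fin: "finite (orbit12 q)" for q by (simp add: orbit12_def split: prod.split)
  define e where "e c = cis (pi * real_of_int c / 6)" for c
  have mult: "e c * e d = e (c + d)" for c d
    by (simp add: e_def cis_mult field_simps)
  have cnj: "cnj (e c) = e (- c)" for c
    by (simp add: e_def cis_cnj)
  have norm: "cmod (e c) = 1" for c
    by (simp add: e_def)
  have period: "e c = e d" if "c = d + 12" for c d
    unfolding e_def cis_eq_iff_mod12 that by simp
  have "e (- 4 - k) = e (- k - 4)"
    by (rule arg_cong[of _ _ e]) simp
  \<comment> \<open>Shifts by the period 12 bring the exponents arising in \<open>R2\<close> and
    \<open>R3\<close> to those of \<alpha> times \<open>e 4\<close> or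
    \<open>e (- 4)\<close>.\<close>
  then have e: "e (k + 8) = e (k - 4)" "e (- k - 8) = e (4 - k)" "e (- 4 - k) = e (- k - 4)"
    "e (- 8) = e 4" "e 8 = e (- 4)" "e 16 = e 4"
    using period[of "k + 8" "k - 4"] period[of "4 - k" "- k - 8"] period[of 4 "- 8"]
      period[of 8 "- 4"] period[of 16 4]
    by simp_all
  have omega: "omega = e 4"
    by (simp add: e_def)
  then have omega2: "omega\<^sup>2 = e (- 4)"
    by (metis omega_sq cnj)
  have \<alpha>: "\<alpha> = 1 + e k + e (- k)"
    by (simp add: \<alpha>_def e_def complex_eq_iff)
  have R: "R m n (grid12 (a, b)) = (e a + e (- b) + e (b - a)) ^ m * (e (- a) + e b + e (a - b)) ^ n" for a b
    by (simp add: grid12_def R_torus cnj mult norm flip: e_def)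
  have R1: "R m n (grid12 (k, k)) = \<alpha> ^ m * \<alpha> ^ n"
    by (simp add: R \<alpha> e_def add_ac)
  have R2: "R m n (grid12 (- 4 - k, 4)) = (\<alpha> * e (- 4)) ^ m * (\<alpha> * e 4) ^ n"
    by (simp add: R \<alpha> e distrib_right mult add_ac)
  have R3: "R m n (grid12 (4, - 4 - k)) = (\<alpha> * e 4) ^ m * (\<alpha> * e (- 4)) ^ n"
    by (simp add: R \<alpha> e distrib_right mult add_ac)
  have "(\<Sum>p\<in>grid12 ` support12 k. R m n p) = (\<Sum>q\<in>support12 k. R m n (grid12 q))"
    using inj_on_support12[OF assms(1)] by (simp add: sum.reindex)
  also have "\<dots> = 6 * (R m n (grid12 (k, k)) + R m n (grid12 (- 4 - k, 4)) + R m n (grid12 (4, - 4 - k)))"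
    unfolding support12_def
    by (simp add: sum.union_disjoint fin disj orb card)
  also have "\<dots> = 6 * (\<Sum>\<zeta>\<leftarrow>[1, omega, omega\<^sup>2]. (\<alpha> * \<zeta>) ^ m * (\<alpha> * \<zeta>\<^sup>2) ^ n)"
    unfolding R1 R2 R3 list.map sum_list.Cons sum_list.Nil omega2 omega
    by (simp add: power2_eq_square mult e algebra_simps)
  finally show ?thesis .
qed

section \<open>The density on the grid \<open>D 4\<close>\<close>

lemma sin_multiple_of_3:
  assumes "3 dvd j"
  shows "sin (pi * real_of_int j / 6) = of_int (if j mod 12 = 3 then 1 else if j mod 12 = 9 then - 1 else 0)"
proof -
  have "cis (pi * j / 6) = cis (pi * (j mod 12) / 6)"
    by (rule iffD2[OF cis_eq_iff_mod12]) simp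
  then have "sin (pi * j / 6) = sin (pi * (j mod 12) / 6)"
    by (metis cis.sel(2))
  moreover have "j mod 12 \<in> {0, 3, 6, 9}" using assms by auto presburger
  moreover have "sin (pi * 3 / 6) = 1" "sin (pi * 9 / 6) = - 1" "sin (pi * 6 / 6) = 0"
    using sin_3over2_pi by (simp_all add: mult.commute)
  ultimately show ?thesis by auto
qed

lemma D_4: "D 4 = grid12 ` {(a, b). a \<in> {0..<12} \<and> b \<in> {0..<12} \<and> 3 dvd a + b}"
    (is "_ = grid12 ` ?I")
proof (rule equalityI; rule subsetI)
  fix p assume "p \<in> D 4"
  then obtain q1 q2 where q: "q1 < 12" "q2 < 12" "(q1 + q2) mod 3 = 0"
      "p = (cis (2 * pi * real q1 / 12), cis (2 * pi * real q2 / 12))"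
    by (auto simp: D_def)
  then have "p = grid12 (int q1, int q2)"
    by (simp add: grid12_def)
  moreover have "3 dvd int q1 + int q2"
    using q(3) by presburger
  ultimately show "p \<in> grid12 ` ?I"
    using q by auto
next
  fix p assume "p \<in> grid12 ` ?I"
  then obtain a b where ab: "a \<in> {0..<12}" "b \<in> {0..<12}" "3 dvd a + b" "p = grid12 (a, b)"
    by auto
  have "p = (cis (2 * pi * real (nat a) / (3 * real 4)), cis (2 * pi * real (nat b) / (3 * real 4)))"
    using ab by (simp add: grid12_def)
  moreover have "nat a < 3 * 4" "nat b < 3 * 4"
    using ab by auto
  moreover have "(nat a + nat b) mod 3 = 0"
    using ab(1-3) by (metis atLeastLessThan_iff add_nonneg_nonneg nat_add_distrib nat_mod_distrib
        dvd_eq_mod_eq_0 nat_numeral nat_0 zero_le_numeral)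
  ultimately show "p \<in> D 4"
    unfolding D_def mem_Collect_eq by (intro exI conjI)
qed

text \<open>On \<open>D 4\<close> the arguments of the three sines in \<open>J\<close> are multiples of \<open>\<pi> / 2\<close>, so \<open>J\<close> is
  \<open>4 \<pi>\<^sup>2\<close> times an integer.\<close>

definition J_value12 :: "int \<Rightarrow> int \<Rightarrow> int" where
  "J_value12 a b = (let t = (\<lambda>j. if j mod 12 = 3 then 1 else if j mod 12 = 9 then - 1 else (0::int))
     in t (a + b) - t (2 * a - b) - t (2 * b - a))"

text \<open>Checked by evaluating all residue pairs; \<open>mod12\<close> is applied on the right
  because \<open>support12 3\<close> contains exponents outside the range from 0 to 11.\<close>

lemma J_value12:
  assumes "a \<in> {0..<12}" "b \<in> {0..<12}" "3 dvd a + b"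
  shows "(J_value12 a b)\<^sup>2 = (if (a, b) \<in> mod12 ` support12 3 then 4 else 0)"
proof -
  have "\<forall>a\<in>set [0..11]. \<forall>b\<in>set [0..11]. 3 dvd a + b \<longrightarrow>
    (J_value12 a b)\<^sup>2 = (if (a, b) \<in> mod12 ` support12 3 then 4 else 0)"
    unfolding J_value12_def support12_def mod12_def orbit12_def by code_simp
  with assms show ?thesis by simp
qed

lemma card_D_4: "card (D 4) = 48"
proof -
  let ?I = "{(a, b). a \<in> {0..<12} \<and> b \<in> {0..<12} \<and> 3 dvd a + b} :: (int \<times> int) set"
  have "inj_on grid12 ?I"
    by (auto simp: inj_on_def grid12_eq_iff mod12_def)
  moreover have "?I = set (filter (\<lambda>(a, b). 3 dvd a + b) (List.product [0..11] [0..11]))"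
    by auto
  moreover have "card (set (filter (\<lambda>(a, b). 3 dvd a + b) (List.product [0..11] [0..11::int]))) = 48"
    by code_simp
  ultimately show ?thesis by (simp add: D_4 card_image)
qed

text \<open>The value arises as (4 pi^2)^2 times the square 4 of the integer
  \<open>J_value12 a b\<close>.\<close>

lemma J_sq_D_4:
  assumes "p \<in> D 4"
  shows "(J p)\<^sup>2 = (if p \<in> grid12 ` support12 3 then 64 * pi ^ 4 else 0)"
proof -
  obtain a b where ab: "a \<in> {0..<12}" "b \<in> {0..<12}" "3 dvd a + b" and p: "p = grid12 (a, b)"
    using assms by (auto simp: D_4)
  have angles: "pi * real_of_int a / 6 = 2 * pi * (a / 12)" "pi * real_of_int b / 6 = 2 * pi * (b / 12)"
    "2 * pi * (a / 12 + b / 12) = pi * real_of_int (a + b) / 6"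
    "2 * pi * (2 * (a / 12) - b / 12) = pi * real_of_int (2 * a - b) / 6"
    "2 * pi * (2 * (b / 12) - a / 12) = pi * real_of_int (2 * b - a) / 6"
    by (simp_all add: field_simps)
  have dvd: "3 dvd 2 * a - b" "3 dvd 2 * b - a"
    using ab(3) by presburger+
  have "J p = 4 * pi\<^sup>2 * (sin (pi * real_of_int (a + b) / 6)
      - sin (pi * real_of_int (2 * a - b) / 6) - sin (pi * real_of_int (2 * b - a) / 6))"
    unfolding p grid12_def prod.case angles(1,2) J_cis J_angle_def angles(3-5) ..
  also have "\<dots> = 4 * pi\<^sup>2 * real_of_int (J_value12 a b)"
    unfolding sin_multiple_of_3[OF ab(3)] sin_multiple_of_3[OF dvd(1)] sin_multiple_of_3[OF dvd(2)]
    by (simp only: J_value12_def Let_def of_int_diff)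
  finally have "(J p)\<^sup>2 = 16 * pi ^ 4 * real_of_int ((J_value12 a b)\<^sup>2)"
    by (simp add: power_mult_distrib)
  moreover have "p \<in> grid12 ` support12 3 \<longleftrightarrow> (a, b) \<in> mod12 ` support12 3"
  proof -
    have "mod12 (a, b) = (a, b)"
      using ab by (simp add: mod12_def)
    then show ?thesis
      by (simp add: p grid12_eq_iff image_iff)
  qed
  ultimately show ?thesis
    by (simp add: J_value12[OF ab])
qed

text \<open>Divisibility of the exponent sum by 3 is checked on unreduced exponents and survives
  reduction modulo 12, as 3 divides 12.\<close>

lemma support12_3_subset_D_4: "grid12 ` support12 3 \<subseteq> D 4"
proof
  fix p assume "p \<in> grid12 ` support12 3"
  then obtain a b where ab: "(a, b) \<in> support12 3" "p = grid12 (a, b)"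
    by auto
  have "\<forall>q\<in>support12 3. 3 dvd fst q + snd q"
    by code_simp
  with ab have "3 dvd a + b" by auto
  then have "3 dvd a mod 12 + b mod 12" by presburger
  moreover have "p = grid12 (a mod 12, b mod 12)"
    using ab(2) grid12_mod12[of "(a, b)"] by (simp add: mod12_def)
  ultimately show "p \<in> D 4"
    unfolding D_4 by auto
qed

section \<open>Spectral decomposition of the graph\<close>

fun E1_12_mult :: "vertex \<Rightarrow> vertex \<Rightarrow> nat" where
  "E1_12_mult (Ai i) (Bi j) = of_bool (i = j)"
| "E1_12_mult A (Bi i) = 1"
| "E1_12_mult A B = 2"
| "E1_12_mult (Bi i) (Ci j) = of_bool (i = j)"
| "E1_12_mult (Bi i) C = 1"
| "E1_12_mult B (Ci i) = 1"
| "E1_12_mult B C = 1"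
| "E1_12_mult (Ci i) (Ai j) = of_bool (i = j)"
| "E1_12_mult (Ci i) A = 1"
| "E1_12_mult C A = 2"
| "E1_12_mult _ _ = 0"

text \<open>The labels of the arcs from \<open>v\<close> to \<open>w\<close> are exactly the numbers
  below the multiplicity, so counting arcs becomes a table lookup.\<close>

lemma adjacency_E1_12: "adjacency E1_12 $ v $ w = of_nat (E1_12_mult v w)"
proof -
  have "{e \<in> arcs E1_12. tail E1_12 e = v \<and> head E1_12 e = w} =
      (\<lambda>k. (v, w, k)) ` {..<E1_12_mult v w}"
    by (cases v; cases w) (auto simp: E1_12_def numeral_2_eq_2 lessThan_Suc)
  moreover have "inj_on (\<lambda>k. (v, w, k)) {..<E1_12_mult v w}"
    by (auto intro: inj_onI)
  ultimately show ?thesis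
    by (simp add: adjacency_def card_image)
qed

lemma sum_vertex:
  "(\<Sum>v\<in>UNIV. f v) =
    f A + f B + f C + (\<Sum>i\<in>UNIV. f (Ai i)) + (\<Sum>i\<in>UNIV. f (Bi i)) + (\<Sum>i\<in>UNIV. f (Ci i))"
  for f :: "vertex \<Rightarrow> 'a::comm_monoid_add"
proof -
  have UNIV: "UNIV = {A, B, C} \<union> (range Ai \<union> (range Bi \<union> range Ci))"
    by (auto intro: vertex.exhaust)
  have "sum f UNIV = sum f {A, B, C} + (sum f (range Ai) + (sum f (range Bi) + sum f (range Ci)))"
    unfolding UNIV by (subst sum.union_disjoint; auto)+
  then show ?thesis
    by (simp add: sum.reindex inj_on_def ac_simps)
qed

lemma adjacency_E1_12_mult_vec:
  "(adjacency E1_12 *v x) $ v =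
    (case v of A \<Rightarrow> (\<Sum>i\<in>UNIV. x $ Bi i) + 2 * x $ B
       | B \<Rightarrow> (\<Sum>i\<in>UNIV. x $ Ci i) + x $ C
       | C \<Rightarrow> 2 * x $ A
       | Ai i \<Rightarrow> x $ Bi i
       | Bi i \<Rightarrow> x $ Ci i + x $ C
       | Ci i \<Rightarrow> x $ Ai i + x $ A)"
  by (cases v) (simp_all add: matrix_vector_mult_def adjacency_E1_12 sum_vertex
      of_bool_def if_distrib if_distribR cong: if_cong)

lemma adjoint_E1_12_mult_vec:
  "(adjoint_mat (adjacency E1_12) *v x) $ v =
    (case v of A \<Rightarrow> (\<Sum>i\<in>UNIV. x $ Ci i) + 2 * x $ C
       | B \<Rightarrow> 2 * x $ A
       | C \<Rightarrow> (\<Sum>i\<in>UNIV. x $ Bi i) + x $ B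
       | Ai i \<Rightarrow> x $ Ci i
       | Bi i \<Rightarrow> x $ Ai i + x $ A
       | Ci i \<Rightarrow> x $ Bi i + x $ B)"
  by (cases v) (simp_all add: matrix_vector_mult_def adjoint_mat_def adjacency_E1_12 sum_vertex
      of_bool_def if_distrib if_distribR cong: if_cong)

text \<open>Both products are compared by their action on an arbitrary vector, coordinate by
  coordinate.\<close>

lemma normal_E1_12: "normal_mat (adjacency E1_12)"
  unfolding normal_mat_def matrix_eq matrix_vector_mul_assoc[symmetric] vec_eq_iff
  by (auto simp: adjacency_E1_12_mult_vec adjoint_E1_12_mult_vec sum.distrib split: vertex.split)

text \<open>For \<open>s\<^sup>2 = 3\<close> and \<open>\<zeta>\<^sup>3 = 1\<close> these are the eigenvectors for \<open>(1 + s) \<zeta>\<close> that do not depend on the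
  index \<open>i\<close>; the conjugate eigenvalue of the adjoint is \<open>(1 + s) \<zeta>\<^sup>2\<close>.\<close>

definition sym_eigenvec :: "complex \<Rightarrow> complex \<Rightarrow> complex ^ vertex" where
  "sym_eigenvec s \<zeta> = (\<chi> v. case v of A \<Rightarrow> 3 + 2 * s | B \<Rightarrow> (3 + s) * \<zeta> | C \<Rightarrow> (3 + s) * \<zeta>\<^sup>2
     | Ai i \<Rightarrow> 1 | Bi i \<Rightarrow> (1 + s) * \<zeta> | Ci i \<Rightarrow> (1 + s) * \<zeta>\<^sup>2)"

text \<open>The pattern 2, -1, -1 is three times the part of the first unit vector orthogonal to the
  constants. Its sum is zero, so the entries at \<open>A\<close>, \<open>B\<close>, \<open>C\<close>
  can vanish.\<close>

definition asym_eigenvec :: "complex \<Rightarrow> complex ^ vertex" where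
  "asym_eigenvec \<zeta> = (\<chi> v. case v of
     Ai i \<Rightarrow> if i = 1 then 2 else - 1 | Bi i \<Rightarrow> (if i = 1 then 2 else - 1) * \<zeta>
     | Ci i \<Rightarrow> (if i = 1 then 2 else - 1) * \<zeta>\<^sup>2 | _ \<Rightarrow> 0)"

lemma sym_eigenvec:
  assumes "s\<^sup>2 = 3" "\<zeta> ^ 3 = 1"
  shows "adjacency E1_12 *v sym_eigenvec s \<zeta> = ((1 + s) * \<zeta>) *s sym_eigenvec s \<zeta>"
    and "adjoint_mat (adjacency E1_12) *v sym_eigenvec s \<zeta> = ((1 + s) * \<zeta>\<^sup>2) *s sym_eigenvec s \<zeta>"
proof -
  have s: "s * s = 3" and z: "\<zeta> * (\<zeta> * \<zeta>) = 1"
    using assms by (simp_all add: power2_eq_square power3_eq_cube ac_simps)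
  have reduce: "s * (s * x) = 3 * x" "\<zeta> * (\<zeta> * (\<zeta> * x)) = x" for x
    using s z by (metis mult.assoc mult_1)+
  note reduce = s z reduce
  show "adjacency E1_12 *v sym_eigenvec s \<zeta> = ((1 + s) * \<zeta>) *s sym_eigenvec s \<zeta>"
    unfolding vec_eq_iff adjacency_E1_12_mult_vec sym_eigenvec_def
    by (auto split: vertex.split simp: power2_eq_square algebra_simps reduce)
  show "adjoint_mat (adjacency E1_12) *v sym_eigenvec s \<zeta> = ((1 + s) * \<zeta>\<^sup>2) *s sym_eigenvec s \<zeta>"
    unfolding vec_eq_iff adjoint_E1_12_mult_vec sym_eigenvec_def
    by (auto split: vertex.split simp: power2_eq_square algebra_simps reduce)
qed

lemma asym_eigenvec:
  assumes "\<zeta> ^ 3 = 1"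
  shows "adjacency E1_12 *v asym_eigenvec \<zeta> = \<zeta> *s asym_eigenvec \<zeta>"
    and "adjoint_mat (adjacency E1_12) *v asym_eigenvec \<zeta> = \<zeta>\<^sup>2 *s asym_eigenvec \<zeta>"
proof -
  have z: "\<zeta> * (\<zeta> * \<zeta>) = 1"
    using assms by (simp add: power3_eq_cube ac_simps)
  then have z': "\<zeta> * (\<zeta> * (\<zeta> * \<zeta>)) = \<zeta>" by algebra
  show "adjacency E1_12 *v asym_eigenvec \<zeta> = \<zeta> *s asym_eigenvec \<zeta>"
    unfolding vec_eq_iff adjacency_E1_12_mult_vec asym_eigenvec_def
    by (auto split: vertex.split simp: power2_eq_square sum_3 ac_simps z)
  show "adjoint_mat (adjacency E1_12) *v asym_eigenvec \<zeta> = \<zeta>\<^sup>2 *s asym_eigenvec \<zeta>"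
    unfolding vec_eq_iff adjoint_E1_12_mult_vec asym_eigenvec_def
    by (auto split: vertex.split simp: power2_eq_square sum_3 ac_simps z z')
qed

section \<open>Moments from joint eigenvectors\<close>

lemma mat_power_eigenvec:
  assumes "M *v x = l *s x"
  shows "mat_power M n *v x = l ^ n *s x"
  using assms
  by (induction n) (simp_all add: matrix_vector_mul_assoc[symmetric] vector_scalar_commute
      vector_smult_assoc mult.commute)

lemma mat_power_joint_eigenvec:
  assumes "M *v x = l *s x" "M' *v x = l' *s x"
  shows "(mat_power M m ** mat_power M' n) *v x = (l ^ m * l' ^ n) *s x"
  by (simp add: matrix_vector_mul_assoc[symmetric] mat_power_eigenvec[OF assms(1)]
      mat_power_eigenvec[OF assms(2)] vector_scalar_commute vector_smult_assoc mult.commute)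

text \<open>For s = sqrt 3 these are the orthogonal projection coefficients.
  \<open>sym_eigenvec s \<zeta>\<close> has squared norm 36 (2 + s) and entry 1 at
  \<open>Ai 1\<close>, with (2 + s) (2 - s) = 1; \<open>asym_eigenvec \<zeta>\<close> has squared
  norm 18 and entry 2.\<close>

lemma axis_Ai_1:
  fixes s :: complex
  assumes "s\<^sup>2 = 3" "1 + \<omega> + \<omega>\<^sup>2 = 0"
  shows "axis (Ai 1) 1 = (\<Sum>\<zeta>\<leftarrow>[1, \<omega>, \<omega>\<^sup>2]. ((2 - s) / 36) *s sym_eigenvec s \<zeta>
    + ((2 + s) / 36) *s sym_eigenvec (- s) \<zeta> + (1 / 9) *s asym_eigenvec \<zeta>)"
proof -
  have s: "s * s = 3" using assms by (simp_all add: power2_eq_square)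
  have w: "\<omega> * \<omega> = - 1 - \<omega>" using assms by (simp add: power2_eq_square algebra_simps eq_neg_iff_add_eq_0)
  have reduce: "\<omega> * (\<omega> * x) = - x - \<omega> * x" for x
    using w by (metis left_diff_distrib mult.assoc mult_1 mult_minus1)
  show ?thesis
    unfolding vec_eq_iff sym_eigenvec_def asym_eigenvec_def
    by (auto split: vertex.split simp: axis_def power2_eq_square field_simps s w reduce)
qed

lemma hermitian_inner_axis: "hermitian_inner x (axis v 1) = x $ v"
proof -
  have "hermitian_inner x (axis v 1) = (\<Sum>w\<in>UNIV. if w = v then x $ w else 0)"
    unfolding hermitian_inner_def by (intro sum.cong) (auto simp: axis_def)
  then show ?thesis by simp
qed

lemma moments_E1_12:
  assumes "s\<^sup>2 = 3" "1 + \<omega> + \<omega>\<^sup>2 = 0"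
  shows "hermitian_inner ((mat_power (adjacency E1_12) m **
      mat_power (adjoint_mat (adjacency E1_12)) n) *v axis (Ai 1) 1) (axis (Ai 1) 1) =
    (\<Sum>\<zeta>\<leftarrow>[1, \<omega>, \<omega>\<^sup>2]. (2 - s) / 36 * (((1 + s) * \<zeta>) ^ m * ((1 + s) * \<zeta>\<^sup>2) ^ n)
      + (2 + s) / 36 * (((1 - s) * \<zeta>) ^ m * ((1 - s) * \<zeta>\<^sup>2) ^ n) + 2 / 9 * (\<zeta> ^ m * (\<zeta>\<^sup>2) ^ n))"
proof -
  define T where "T = mat_power (adjacency E1_12) m ** mat_power (adjoint_mat (adjacency E1_12)) n"
  have "\<omega> ^ 3 - 1 = (\<omega> - 1) * (1 + \<omega> + \<omega>\<^sup>2)"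
    by (simp add: power3_eq_cube power2_eq_square algebra_simps)
  then have \<omega>: "\<omega> ^ 3 = 1"
    using assms(2) by simp
  have "(\<omega>\<^sup>2) ^ 3 = (\<omega> ^ 3)\<^sup>2"
    by (simp flip: power_mult add: mult.commute)
  then have \<omega>': "(\<omega>\<^sup>2) ^ 3 = 1" using \<omega> by simp
  have s': "(- s)\<^sup>2 = 3" using assms by simp
  have sym: "T *v sym_eigenvec t \<zeta> = (((1 + t) * \<zeta>) ^ m * ((1 + t) * \<zeta>\<^sup>2) ^ n) *s sym_eigenvec t \<zeta>"
    if "t\<^sup>2 = 3" "\<zeta> ^ 3 = 1" for t \<zeta>
    unfolding T_def using that by (intro mat_power_joint_eigenvec sym_eigenvec)
  have asym: "T *v asym_eigenvec \<zeta> = (\<zeta> ^ m * (\<zeta>\<^sup>2) ^ n) *s asym_eigenvec \<zeta>" if "\<zeta> ^ 3 = 1" for \<zeta>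
    unfolding T_def using that by (intro mat_power_joint_eigenvec asym_eigenvec)
  \<comment> \<open>The entries at \<open>Ai 1\<close> are 1, 1 and 2, so the coefficient 1/9
    becomes 2/9.\<close>
  have component: "(T *v (((2 - s) / 36) *s sym_eigenvec s \<zeta> + ((2 + s) / 36) *s sym_eigenvec (- s) \<zeta>
      + (1 / 9) *s asym_eigenvec \<zeta>)) $ Ai 1 =
    (2 - s) / 36 * (((1 + s) * \<zeta>) ^ m * ((1 + s) * \<zeta>\<^sup>2) ^ n)
      + (2 + s) / 36 * (((1 - s) * \<zeta>) ^ m * ((1 - s) * \<zeta>\<^sup>2) ^ n) + 2 / 9 * (\<zeta> ^ m * (\<zeta>\<^sup>2) ^ n)"
    if "\<zeta> ^ 3 = 1" for \<zeta>
    unfolding matrix_vector_right_distrib vector_scalar_commute sym[OF assms(1) that]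
      sym[OF s' that] asym[OF that]
    by (simp add: sym_eigenvec_def asym_eigenvec_def)
  have "(T *v axis (Ai 1) 1) $ Ai 1 = (\<Sum>\<zeta>\<leftarrow>[1, \<omega>, \<omega>\<^sup>2].
      (T *v (((2 - s) / 36) *s sym_eigenvec s \<zeta> + ((2 + s) / 36) *s sym_eigenvec (- s) \<zeta>
        + (1 / 9) *s asym_eigenvec \<zeta>)) $ Ai 1)"
    unfolding axis_Ai_1[OF assms] list.map sum_list.Cons sum_list.Nil
    by (simp only: matrix_vector_right_distrib vector_add_component add_0_right)
  also have "\<dots> = (\<Sum>\<zeta>\<leftarrow>[1, \<omega>, \<omega>\<^sup>2]. (2 - s) / 36 * (((1 + s) * \<zeta>) ^ m * ((1 + s) * \<zeta>\<^sup>2) ^ n)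
      + (2 + s) / 36 * (((1 - s) * \<zeta>) ^ m * ((1 - s) * \<zeta>\<^sup>2) ^ n) + 2 / 9 * (\<zeta> ^ m * (\<zeta>\<^sup>2) ^ n))"
    unfolding list.map by (subst (1 2 3) component) (use \<omega> \<omega>' in simp_all)
  finally show ?thesis
    by (simp add: hermitian_inner_axis T_def)
qed

section \<open>Comparison of the moments\<close>

theorem theorem2p4:
  shows "spectral_measure_at E1_12 (Ai 1)
    (add_measure
      (add_measure
        (scale_measure (ennreal ((2 - sqrt 3) / 12)) (d_orbits 12))
        (scale_measure (ennreal ((2 + sqrt 3) / 12)) (d_orbits (12 / 5))))
      (scale_measure (ennreal (1 / (36 * pi ^ 4)))
        (density (d_grid 4) (\<lambda>p. ennreal ((J p)\<^sup>2)))))"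
    (is "spectral_measure_at _ _ ?\<epsilon>")
proof -
  let ?T = "\<lambda>k. grid12 ` support12 k"
  define S where "S = ?T 1 \<union> ?T 5 \<union> D 4"
  \<comment> \<open>The denominators are cardinalities: 18 for each orbit support, 48 for
    \<open>D 4\<close>.\<close>
  define w where "w p = (2 - sqrt 3) / 12 * (indicator (?T 1) p / 18)
      + (2 + sqrt 3) / 12 * (indicator (?T 5) p / 18)
      + 1 / (36 * pi ^ 4) * ((J p)\<^sup>2 * (indicator (D 4) p / 48))" for p
  have "finite (D 4)"
    using card_D_4 by (simp add: card_ge_0_finite)
  then have S: "finite S" "S \<subseteq> torus"
    by (auto simp: S_def support12_def orbit12_def torus_def D_4 grid12_def)
  \<comment> \<open>Nonnegative coefficients ensure that \<open>ennreal\<close> does not truncate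
    them.\<close>
  have sqrt3: "0 \<le> 2 - sqrt 3" "0 \<le> 2 + sqrt 3"
    by (auto intro: real_le_lsqrt)
  have card: "card (?T k) = 18" if "k \<in> {1, 3, 5}" for k
    using card_image[OF inj_on_support12[OF that]] support12_card[OF that] by simp
  have "d_orbits 12 = uniform_on (?T 1)" "d_orbits (12 / 5) = uniform_on (?T 5)"
    by (rule d_orbits_eq; simp add: of_rat_divide)+
  then have d: "d_orbits 12 = atomic_measure torus_borel S (\<lambda>p. indicator (?T 1) p / 18)"
    "d_orbits (12 / 5) = atomic_measure torus_borel S (\<lambda>p. indicator (?T 5) p / 18)"
    "d_grid 4 = atomic_measure torus_borel S (\<lambda>p. indicator (D 4) p / 48)"
    using uniform_on_eq_atomic_measure[OF S, of "?T 1"] uniform_on_eq_atomic_measure[OF S, of "?T 5"]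
      uniform_on_eq_atomic_measure[OF S, of "D 4"] card_D_4
    by (simp_all add: card d_grid_def) (auto simp: S_def)
  have S': "S \<subseteq> space torus_borel"
    using S by (simp add: space_torus_borel)
  have \<epsilon>: "?\<epsilon> = atomic_measure torus_borel S w"
    unfolding d w_def using S S' sqrt3
    by (simp only: density_atomic_measure[OF S(1) S' borel_measurable_power[OF borel_measurable_J]]
        zero_le_power2) (simp add: scale_atomic_measure add_atomic_measure)
  have w_nonneg: "0 \<le> w p" for p
    using sqrt3 by (simp add: w_def)
  have moments: "(\<Sum>p\<in>S. w p *\<^sub>R R m n p) = hermitian_inner
      ((mat_power (adjacency E1_12) m ** mat_power (adjoint_mat (adjacency E1_12)) n) *v axis (Ai 1) 1)
      (axis (Ai 1) 1)" for m n
  proof -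
    have J: "(\<Sum>p\<in>S. (1 / (36 * pi ^ 4) * ((J p)\<^sup>2 * (indicator (D 4) p / 48))) *\<^sub>R R m n p) =
        (\<Sum>p\<in>S. (2 / 3 * (indicator (?T 3) p / 18)) *\<^sub>R R m n p)"
    proof (intro sum.cong refl)
      fix p
      \<comment> \<open>On \<open>?T 3\<close> both sides are 64 / (36 * 48) = 1/27 = (2/3) / 18;
        elsewhere both vanish.\<close>
      have "1 / (36 * pi ^ 4) * ((J p)\<^sup>2 * (indicator (D 4) p / 48)) = 2 / 3 * (indicator (?T 3) p / 18)"
        using J_sq_D_4[of p] support12_3_subset_D_4
        by (cases "p \<in> D 4"; cases "p \<in> ?T 3") auto
      then show "(1 / (36 * pi ^ 4) * ((J p)\<^sup>2 * (indicator (D 4) p / 48))) *\<^sub>R R m n p =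
          (2 / 3 * (indicator (?T 3) p / 18)) *\<^sub>R R m n p"
        by simp
    qed
    have sub: "?T 1 \<subseteq> S" "?T 5 \<subseteq> S" "?T 3 \<subseteq> S"
      using support12_3_subset_D_4 by (auto simp: S_def)
    have angles: "pi * real_of_int 1 / 6 = pi / 6" "pi * real_of_int 5 / 6 = pi - pi / 6"
      "pi * real_of_int 3 / 6 = pi / 2"
      by simp_all
    have cos: "complex_of_real (1 + 2 * cos (pi * real_of_int 1 / 6)) = 1 + of_real (sqrt 3)"
      "complex_of_real (1 + 2 * cos (pi * real_of_int 5 / 6)) = 1 - of_real (sqrt 3)"
      "complex_of_real (1 + 2 * cos (pi * real_of_int 3 / 6)) = 1"
      unfolding angles cos_pi_minus cos_30 cos_pi_half by simp_all
    have T: "(\<Sum>p\<in>?T 1. R m n p) = 6 * (\<Sum>\<zeta>\<leftarrow>[1, omega, omega\<^sup>2].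
          ((1 + of_real (sqrt 3)) * \<zeta>) ^ m * ((1 + of_real (sqrt 3)) * \<zeta>\<^sup>2) ^ n)"
      "(\<Sum>p\<in>?T 5. R m n p) = 6 * (\<Sum>\<zeta>\<leftarrow>[1, omega, omega\<^sup>2].
          ((1 - of_real (sqrt 3)) * \<zeta>) ^ m * ((1 - of_real (sqrt 3)) * \<zeta>\<^sup>2) ^ n)"
      "(\<Sum>p\<in>?T 3. R m n p) = 6 * (\<Sum>\<zeta>\<leftarrow>[1, omega, omega\<^sup>2]. \<zeta> ^ m * (\<zeta>\<^sup>2) ^ n)"
      using sum_R_support12[of 1 m n] sum_R_support12[of 5 m n] sum_R_support12[of 3 m n]
      unfolding cos mult_1 by blast+
    have sq: "(complex_of_real (sqrt 3))\<^sup>2 = 3"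
      by (simp flip: of_real_power)
    have "(\<Sum>p\<in>S. w p *\<^sub>R R m n p) = of_real ((2 - sqrt 3) / 12 / 18) * (\<Sum>p\<in>?T 1. R m n p)
        + of_real ((2 + sqrt 3) / 12 / 18) * (\<Sum>p\<in>?T 5. R m n p)
        + of_real (2 / 3 / 18) * (\<Sum>p\<in>?T 3. R m n p)"
      unfolding w_def scaleR_add_left sum.distrib J sum_indicator_scaleR_subset[OF S(1) sub(1)]
        sum_indicator_scaleR_subset[OF S(1) sub(2)] sum_indicator_scaleR_subset[OF S(1) sub(3)] ..
    \<comment> \<open>The factor 6 from \<open>T\<close> turns the weights per point into exactly
      the coefficients of \<open>moments_E1_12\<close>.\<close>
    moreover have "of_real ((2 - sqrt 3) / 12 / 18) * (6 * x) = (2 - of_real (sqrt 3)) / 36 * x"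
      "of_real ((2 + sqrt 3) / 12 / 18) * (6 * x) = (2 + of_real (sqrt 3)) / 36 * x"
      "of_real (2 / 3 / 18) * (6 * x) = 2 / 9 * x" for x :: complex
      by simp_all
    ultimately show ?thesis
      unfolding T moments_E1_12[OF sq omega_sum] sum_list_addf sum_list_const_mult by (simp only:)
  qed
  have "has_bochner_integral ?\<epsilon> (R m n) (\<Sum>p\<in>S. w p *\<^sub>R R m n p)" for m n
    unfolding \<epsilon> using S(1) S' borel_measurable_torus[OF continuous_on_R] w_nonneg
    by (rule has_bochner_integral_atomic_measure)
  moreover have "space ?\<epsilon> = torus" "sets ?\<epsilon> = sets torus_borel"
    by (simp_all only: \<epsilon> space_atomic_measure sets_atomic_measure space_torus_borel)
  moreover have "verts E1_12 = UNIV"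
    by (simp add: E1_12_def)
  ultimately show ?thesis
    unfolding spectral_measure_at_def moments
    using fin_digraph_E1_12 normal_E1_12 by blast
qed

end
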